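(* Let $M\subset E^{n}$ be a strong $r$-helix submanifold of dimension $n-k$ with space of helix directions $H(M)\subset E^{n}$. Let $\alpha : I\subset\mathbb{R}\to M$ be a unit speed geodesic curve on $M$, let $V_2$ be the unit principal normal of $\alpha$ in $E^n$, and let $\xi_j$ be the normal component of a direction $d_j\in H(M)$. If $\langle V_2,\xi_j\rangle$ is a constant function along $\alpha$, then $\alpha$ is a slant helix in $E^{n}$.
   Context: $E^{n}=\mathbb{R}^{n}$ is Euclidean $n$-space with its standard inner product; manifolds, curves and fields are $C^\infty$. $\overline{D}$ is the standard covariant derivative (Riemannian connection) on $E^{n}$ and $D$ is the induced Riemannian connection on $M$; $\alpha$ with unit tangent $T=\alpha'$ is a geodesic of $M$ if $D_TT=0$. Helix directions: let $M\subset \mathbb{R}^{n}$ be a submanifold. A unit vector $d\in\mathbb{R}^{n}$ is a helix direction of $M$ if the angle between $d$ and the tangent space $T_pM$ is constant (independent of $p\in M$). $H(M)$ denotes the set of helix directions of $M$; when it is regarded as a linear space, it consists of all scalar multiples of helix directions, and a "direction $d\in H(M)$" means a unit vector in it. $M$ is a strong $r$-helix submanifold if $H(M)$ is a linear subspace of $\mathbb{R}^{n}$ of dimension greater than or equal to $r$. Components of a direction: for a direction $d_j\in H(M)$, one decomposes $d_j=\cos(\theta_j)\,\xi_j+\sin(\theta_j)\,T_j$ along $M$, with $\theta_j$ constant, $\xi_j$ a unit normal vector field of $M$ and $T_j$ a unit tangent vector field of $M$; $\xi_j$ and $T_j$ are called the normal and tangent components of $d_j$. Principal normal: $V_2$ is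 the second Frenet vector of the unit speed curve $\alpha$ in $E^n$, so that $\overline{D}_TT=\alpha''=k_1V_2$ with $k_1=\|\alpha''\|$; it is presupposed to be defined, i.e. $k_1>0$. Slant helix: a unit speed curve $\alpha: I\to E^{n}$ is a slant helix if its unit principal normal $V_2$ makes a constant angle with some fixed direction $U$ (a constant unit vector of $E^n$). *)

theory Defs
  imports "HOL-Analysis.Analysis"
begin

text \<open>
  \<open>f\<close> is of class \<open>C\<^sup>k\<close> on \<open>S\<close>: the iterated directional derivatives of \<open>f\<close> up to order \<open>k\<close> exist
  on \<open>S\<close> and are continuous there. Derivatives are taken within \<open>S\<close>, and \<open>frechet_derivative\<close>
  is a choice operator, so the notion is meaningful when these derivatives are unique.
  It is only used for open sets, where they are the ordinary derivatives, and for
  nondegenerate real intervals, where they are one-sided at the end points belonging to \<open>S\<close>.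
\<close>

fun Ck_on :: "nat \<Rightarrow> 'a::real_normed_vector set \<Rightarrow> ('a \<Rightarrow> 'b::real_normed_vector) \<Rightarrow> bool" where
  "Ck_on 0 S f \<longleftrightarrow> continuous_on S f"
| "Ck_on (Suc k) S f \<longleftrightarrow> f differentiable_on S \<and>
     (\<forall>v. Ck_on k S (\<lambda>x. frechet_derivative f (at x within S) v))"

definition smooth_on :: "'a::real_normed_vector set \<Rightarrow> ('a \<Rightarrow> 'b::real_normed_vector) \<Rightarrow> bool" where
  "smooth_on S f \<longleftrightarrow> (\<forall>k. Ck_on k S f)"

text \<open>
  Embedded submanifolds without boundary, via flattening charts: near each of its points \<open>M\<close>
  is mapped by an ambient diffeomorphism onto a piece of an \<open>m\<close>-dimensional linear subspace \<open>L\<close>.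
\<close>

definition submanifold :: "nat \<Rightarrow> 'a::euclidean_space set \<Rightarrow> bool" where
  "submanifold m M \<longleftrightarrow>
     (\<forall>p\<in>M. \<exists>U V \<phi> \<psi> L. open U \<and> p \<in> U \<and> open V \<and>
        homeomorphism U V \<phi> \<psi> \<and> smooth_on U \<phi> \<and> smooth_on V \<psi> \<and>
        subspace L \<and> dim L = m \<and> \<phi> ` (M \<inter> U) = L \<inter> (V :: 'a set))"

definition tangent_space :: "'a::euclidean_space set \<Rightarrow> 'a \<Rightarrow> 'a set" where
  "tangent_space M p = {v. \<exists>\<gamma> e. 0 < e \<and> smooth_on {-e<..<e} \<gamma> \<and> \<gamma> ` {-e<..<e} \<subseteq> M \<and>
     \<gamma> (0::real) = p \<and> (\<gamma> has_vector_derivative v) (at 0)}"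

definition smooth_field :: "'a::euclidean_space set \<Rightarrow> ('a \<Rightarrow> 'a) \<Rightarrow> bool" where
  "smooth_field M X \<longleftrightarrow>
     (\<forall>p\<in>M. \<exists>U Y. open U \<and> p \<in> U \<and> smooth_on U Y \<and> (\<forall>x\<in>M \<inter> U. Y x = X x))"

definition unit_tangent_field :: "'a::euclidean_space set \<Rightarrow> ('a \<Rightarrow> 'a) \<Rightarrow> bool" where
  "unit_tangent_field M X \<longleftrightarrow> smooth_field M X \<and>
     (\<forall>p\<in>M. norm (X p) = 1 \<and> X p \<in> tangent_space M p)"

definition unit_normal_field :: "'a::euclidean_space set \<Rightarrow> ('a \<Rightarrow> 'a) \<Rightarrow> bool" where
  "unit_normal_field M X \<longleftrightarrow> smooth_field M X \<and>
     (\<forall>p\<in>M. norm (X p) = 1 \<and> (\<forall>w\<in>tangent_space M p. orthogonal (X p) w))"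

definition orth_proj :: "'a::euclidean_space set \<Rightarrow> 'a \<Rightarrow> 'a" where
  "orth_proj W v = (THE u. u \<in> W \<and> (\<forall>w\<in>W. orthogonal (v - u) w))"

text \<open>Since \<open>x / 0 = 0\<close>, the angle with the zero vector is \<open>pi / 2\<close>.\<close>

definition vec_angle :: "'a::real_inner \<Rightarrow> 'a \<Rightarrow> real" where
  "vec_angle u v = arccos ((u \<bullet> v) / (norm u * norm v))"

text \<open>
  The angle between a vector and a subspace is its angle with its orthogonal projection; by
  the convention above it is \<open>pi / 2\<close> if the vector is orthogonal to the subspace.
\<close>

definition subspace_angle :: "'a::euclidean_space \<Rightarrow> 'a set \<Rightarrow> real" where
  "subspace_angle v W = vec_angle v (orth_proj W v)"

definition helix_direction :: "'a::euclidean_space set \<Rightarrow> 'a \<Rightarrow> bool" where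
  "helix_direction M d \<longleftrightarrow> norm d = 1 \<and> (\<lambda>p. subspace_angle d (tangent_space M p)) constant_on M"

definition helix_space :: "'a::euclidean_space set \<Rightarrow> 'a set" where
  "helix_space M = {c *\<^sub>R d | c d. helix_direction M d}"

definition strong_helix :: "nat \<Rightarrow> 'a::euclidean_space set \<Rightarrow> bool" where
  "strong_helix r M \<longleftrightarrow> subspace (helix_space M) \<and> r \<le> dim (helix_space M)"

definition normal_component :: "'a::euclidean_space set \<Rightarrow> 'a \<Rightarrow> ('a \<Rightarrow> 'a) \<Rightarrow> bool" where
  "normal_component M d \<xi> \<longleftrightarrow> unit_normal_field M \<xi> \<and>
     (\<exists>\<theta> T. unit_tangent_field M T \<and> (\<forall>p\<in>M. d = cos \<theta> *\<^sub>R \<xi> p + sin \<theta> *\<^sub>R T p))"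

definition velocity :: "real set \<Rightarrow> (real \<Rightarrow> 'a::euclidean_space) \<Rightarrow> real \<Rightarrow> 'a" where
  "velocity I \<alpha> t = vector_derivative \<alpha> (at t within I)"

definition unit_speed_curve :: "real set \<Rightarrow> (real \<Rightarrow> 'a::euclidean_space) \<Rightarrow> bool" where
  "unit_speed_curve I \<alpha> \<longleftrightarrow> is_interval I \<and> interior I \<noteq> {} \<and> smooth_on I \<alpha> \<and>
     (\<forall>t\<in>I. norm (velocity I \<alpha> t) = 1)"

text \<open>
  The covariant derivative, along a curve \<open>\<alpha>\<close> in \<open>M\<close>, of a vector field \<open>X\<close> along \<open>\<alpha>\<close>, for the
  connection induced on \<open>M\<close>: the tangential part of the Euclidean derivative of \<open>X\<close>.
\<close>

definition cov_deriv :: "'a::euclidean_space set \<Rightarrow> real set \<Rightarrow> (real \<Rightarrow> 'a) \<Rightarrow> (real \<Rightarrow> 'a) \<Rightarrow> real \<Rightarrow> 'a" where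
  "cov_deriv M I \<alpha> X t = orth_proj (tangent_space M (\<alpha> t)) (vector_derivative X (at t within I))"

definition unit_speed_geodesic :: "'a::euclidean_space set \<Rightarrow> real set \<Rightarrow> (real \<Rightarrow> 'a) \<Rightarrow> bool" where
  "unit_speed_geodesic M I \<alpha> \<longleftrightarrow> unit_speed_curve I \<alpha> \<and> \<alpha> ` I \<subseteq> M \<and>
     (\<forall>t\<in>I. cov_deriv M I \<alpha> (velocity I \<alpha>) t = 0)"

definition curvature :: "real set \<Rightarrow> (real \<Rightarrow> 'a::euclidean_space) \<Rightarrow> real \<Rightarrow> real" where
  "curvature I \<alpha> t = norm (vector_derivative (velocity I \<alpha>) (at t within I))"

text \<open>
  For unit speed curves; the principal normal is meaningful only where \<open>curvature I \<alpha> t > 0\<close>.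
\<close>

definition principal_normal :: "real set \<Rightarrow> (real \<Rightarrow> 'a::euclidean_space) \<Rightarrow> real \<Rightarrow> 'a" where
  "principal_normal I \<alpha> t =
     vector_derivative (velocity I \<alpha>) (at t within I) /\<^sub>R curvature I \<alpha> t"

definition slant_helix :: "real set \<Rightarrow> (real \<Rightarrow> 'a::euclidean_space) \<Rightarrow> bool" where
  "slant_helix I \<alpha> \<longleftrightarrow> unit_speed_curve I \<alpha> \<and> (\<forall>t\<in>I. curvature I \<alpha> t > 0) \<and>
     (\<exists>U. norm U = 1 \<and> (\<lambda>t. vec_angle (principal_normal I \<alpha> t) U) constant_on I)"

end

theory Submission
  imports Defs
begin

text \<open>
  The axis of the slant helix is the helix direction \<open>d\<close> itself. Write
  \<open>d = cos \<theta> \<xi> + sin \<theta> T\<close> along \<open>M\<close>, with \<open>\<theta>\<close> constant. Since the geodesic \<open>\<alpha>\<close> has no tangential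
  acceleration, its principal normal is orthogonal to \<open>M\<close>, hence to \<open>T\<close>, and therefore
  \<open>\<langle>V\<^sub>2, d\<rangle> = cos \<theta> \<langle>V\<^sub>2, \<xi>\<rangle>\<close>. The right-hand side is constant by hypothesis, and both \<open>V\<^sub>2\<close>
  and \<open>d\<close> are unit vectors, so the angle between them is constant.

  The one point that takes work is that a vanishing projection to the tangent space really means
  orthogonality to it. The tangent space is defined by velocities of curves and
  the projection by a definite description, so it has to be shown first that
  tangent spaces of a submanifold are linear subspaces (\<open>subspace_tangent_space\<close>). This follows
  from a flattening chart: the tangent space is the image of the model subspace under the
  derivative of the inverse chart (\<open>tangent_space_eq_image\<close>).
\<close>

section \<open>Smooth functions along straight lines\<close>

lemma frechet_derivative_cong_on:
  assumes "x \<in> S" and "\<And>y. y \<in> S \<Longrightarrow> f y = g y"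
  shows "frechet_derivative f (at x within S) = frechet_derivative g (at x within S)"
proof -
  have "(f has_derivative D) (at x within S) \<longleftrightarrow> (g has_derivative D) (at x within S)" for D
    using assms by (metis has_derivative_transform)
  then show ?thesis
    by (simp add: frechet_derivative_def)
qed

lemma Ck_on_cong:
  assumes "\<And>x. x \<in> S \<Longrightarrow> f x = g x" and "Ck_on k S f"
  shows "Ck_on k S g"
  using assms
proof (induction k arbitrary: f g)
  case 0
  then show ?case by (metis Ck_on.simps(1) continuous_on_cong)
next
  case (Suc k)
  have "g differentiable_on S"
    using Suc.prems unfolding Ck_on.simps differentiable_on_def differentiable_def
    by (metis has_derivative_transform)
  moreover have "Ck_on k S (\<lambda>x. frechet_derivative g (at x within S) v)" for v
  proof (rule Suc.IH)
    show "frechet_derivative f (at x within S) v = frechet_derivative g (at x within S) v"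
      if "x \<in> S" for x
      using frechet_derivative_cong_on[OF that Suc.prems(1)] by simp
    show "Ck_on k S (\<lambda>x. frechet_derivative f (at x within S) v)"
      using Suc.prems(2) by simp
  qed
  ultimately show ?case by simp
qed

text \<open>
  The derivative of \<open>f (a + t w)\<close> in direction \<open>u\<close> is again a restriction to the line, namely of
  the derivative of \<open>f\<close> in the fixed direction \<open>u w\<close>; this is what makes the induction on the
  order close.
\<close>

lemma Ck_on_line:
  fixes f :: "'a::real_normed_vector \<Rightarrow> 'b::real_normed_vector" and S :: "real set"
  assumes "open V" and "open S" and "\<And>t. t \<in> S \<Longrightarrow> a + t *\<^sub>R w \<in> V" and "Ck_on k V f"
  shows "Ck_on k S (\<lambda>t. f (a + t *\<^sub>R w))"
  using assms(4)
proof (induction k arbitrary: f)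
  case 0
  have "continuous_on S (\<lambda>t. a + t *\<^sub>R w)"
    by (intro continuous_intros)
  then show ?case
    using 0 assms(3) by (auto intro!: continuous_on_compose2[of V f])
next
  case (Suc k)
  let ?l = "\<lambda>t. a + t *\<^sub>R w"
  have deriv: "((\<lambda>t. f (?l t)) has_derivative
      (\<lambda>u. frechet_derivative f (at (?l t) within V) (u *\<^sub>R w))) (at t within S)" if "t \<in> S" for t
  proof -
    have "(f has_derivative frechet_derivative f (at (?l t) within V)) (at (?l t) within V)"
      using Suc.prems assms(3)[OF that]
      by (simp add: differentiable_on_def frechet_derivative_works)
    moreover have "(?l has_derivative (\<lambda>u. u *\<^sub>R w)) (at t within S)"
      by (auto intro!: derivative_eq_intros)
    moreover have "?l ` S \<subseteq> V"
      using assms(3) by blast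
    ultimately show ?thesis
      using has_derivative_in_compose[of ?l "\<lambda>u. u *\<^sub>R w" t S f] has_derivative_subset
      by blast
  qed
  have "(\<lambda>t. f (?l t)) differentiable_on S"
    using deriv unfolding differentiable_on_def differentiable_def by blast
  moreover have "Ck_on k S (\<lambda>t. frechet_derivative (\<lambda>t. f (?l t)) (at t within S) u)" for u
  proof (rule Ck_on_cong)
    show "Ck_on k S (\<lambda>t. frechet_derivative f (at (?l t) within V) (u *\<^sub>R w))"
      using Suc.IH[of "\<lambda>y. frechet_derivative f (at y within V) (u *\<^sub>R w)"] Suc.prems by simp
    show "frechet_derivative f (at (?l t) within V) (u *\<^sub>R w)
        = frechet_derivative (\<lambda>t. f (?l t)) (at t within S) u" if "t \<in> S" for t
      using frechet_derivative_at[of "\<lambda>t. f (?l t)" _ t] deriv[OF that] assms(2) that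
      by (metis at_within_open)
  qed
  ultimately show ?case by simp
qed

lemma smooth_on_has_derivative:
  assumes "smooth_on V f" and "open V" and "x \<in> V"
  shows "(f has_derivative frechet_derivative f (at x)) (at x)"
proof -
  have "Ck_on (Suc 0) V f"
    using assms(1) unfolding smooth_on_def by blast
  then have "f differentiable (at x)"
    using assms(2,3) by (simp add: differentiable_on_eq_differentiable_at)
  then show ?thesis
    by (simp add: frechet_derivative_works)
qed

section \<open>Tangent spaces are linear subspaces\<close>

lemma vector_derivative_in_subspace:
  fixes \<beta> :: "real \<Rightarrow> 'a::euclidean_space"
  assumes "subspace L" and "eventually (\<lambda>t. \<beta> t \<in> L) (at 0)" and "\<beta> 0 \<in> L"
    and "(\<beta> has_vector_derivative v) (at 0)"
  shows "v \<in> L"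
proof (rule Lim_in_closed_set)
  show "closed L"
    using assms(1) by (rule closed_subspace)
  show "((\<lambda>t. (\<beta> t - \<beta> 0) /\<^sub>R t) \<longlongrightarrow> v) (at 0)"
  proof (rule LIM_zero_cancel, rule tendsto_norm_zero_cancel)
    have "((\<lambda>t. norm (\<beta> t - \<beta> 0 - t *\<^sub>R v) / norm t) \<longlongrightarrow> 0) (at 0)"
      using assms(4) by (simp add: has_vector_derivative_def has_derivative_iff_norm)
    then show "((\<lambda>t. norm ((\<beta> t - \<beta> 0) /\<^sub>R t - v)) \<longlongrightarrow> 0) (at 0)"
    proof (rule Lim_transform_eventually)
      have "norm (\<beta> t - \<beta> 0 - t *\<^sub>R v) / norm t = norm ((\<beta> t - \<beta> 0) /\<^sub>R t - v)" if "t \<noteq> 0" for t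
      proof -
        have "(\<beta> t - \<beta> 0) /\<^sub>R t - v = (\<beta> t - \<beta> 0 - t *\<^sub>R v) /\<^sub>R t"
          using that by (simp add: scaleR_diff_right)
        then show ?thesis
          by (simp add: divide_inverse_commute)
      qed
      then show "eventually (\<lambda>t. norm (\<beta> t - \<beta> 0 - t *\<^sub>R v) / norm t
          = norm ((\<beta> t - \<beta> 0) /\<^sub>R t - v)) (at 0)"
        by (simp add: eventually_at_filter)
    qed
  qed
  show "eventually (\<lambda>t. (\<beta> t - \<beta> 0) /\<^sub>R t \<in> L) (at 0)"
    using assms(2) by eventually_elim (simp add: assms(1,3) subspace_scale subspace_diff)
qed simp

text \<open>
  A tangent curve, read in the chart, stays in the model space \<open>L\<close> and so has its velocity there;
  conversely every \<open>w\<close> in \<open>L\<close> is realised by the image of a straight segment in direction \<open>w\<close>.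
\<close>

lemma tangent_space_eq_image:
  fixes M U V L :: "'a::euclidean_space set"
  assumes U: "open U" "p \<in> U" and V: "open V" and pM: "p \<in> M"
    and hom: "homeomorphism U V \<phi> \<psi>" and smooth: "smooth_on U \<phi>" "smooth_on V \<psi>"
    and L: "subspace L" and flat: "\<phi> ` (M \<inter> U) = L \<inter> V"
  shows "tangent_space M p = frechet_derivative \<psi> (at (\<phi> p)) ` L"
proof -
  let ?q = "\<phi> p"
  let ?D = "frechet_derivative \<psi> (at ?q)"
  have q: "?q \<in> L \<inter> V"
    using flat pM U by blast
  have \<psi>\<phi>: "\<psi> (\<phi> x) = x" if "x \<in> U" for x
    using hom that by (simp add: homeomorphism_def)
  have \<psi>_in_M: "\<psi> y \<in> M" if "y \<in> L \<inter> V" for y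
    using that flat \<psi>\<phi> by (metis IntD1 IntD2 imageE)
  have D: "(\<psi> has_derivative ?D) (at ?q)"
    using smooth_on_has_derivative[OF smooth(2) V] q by blast
  show ?thesis
  proof (intro equalityI subsetI)
    fix v assume "v \<in> tangent_space M p"
    then obtain \<gamma> e where e: "0 < e" and \<gamma>M: "\<gamma> ` {-e<..<e} \<subseteq> M" and \<gamma>0: "\<gamma> (0::real) = p"
      and \<gamma>': "(\<gamma> has_vector_derivative v) (at 0)"
      unfolding tangent_space_def by blast
    let ?w = "frechet_derivative \<phi> (at p) v"
    have "(\<phi> has_derivative frechet_derivative \<phi> (at p)) (at (\<gamma> 0))"
      using smooth_on_has_derivative[OF smooth(1) U] \<gamma>0 by simp
    then have \<phi>\<gamma>': "((\<phi> \<circ> \<gamma>) has_vector_derivative ?w) (at 0)"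
      using vector_derivative_diff_chain_within[OF \<gamma>' has_derivative_at_withinI] by blast
    have "(\<gamma> \<longlongrightarrow> \<gamma> 0) (at 0)"
      using has_vector_derivative_continuous[OF \<gamma>'] by (simp add: continuous_at)
    then have "eventually (\<lambda>t. \<gamma> t \<in> U) (at 0)"
      using U \<gamma>0 by (auto dest: topological_tendstoD)
    moreover have "eventually (\<lambda>t. t \<in> {-e<..<e}) (at 0)"
      using e by (intro eventually_at_in_open') auto
    ultimately have inMU: "eventually (\<lambda>t. \<gamma> t \<in> M \<inter> U) (at 0)"
      by eventually_elim (use \<gamma>M in blast)
    then have "eventually (\<lambda>t. (\<phi> \<circ> \<gamma>) t \<in> L) (at 0)"
      by eventually_elim (use flat in auto)
    then have wL: "?w \<in> L"
      using vector_derivative_in_subspace[OF L _ _ \<phi>\<gamma>'] q \<gamma>0 by simp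
    have "((\<psi> \<circ> (\<phi> \<circ> \<gamma>)) has_vector_derivative ?D ?w) (at 0)"
    proof (rule vector_derivative_diff_chain_within[OF \<phi>\<gamma>' has_derivative_at_withinI])
      show "(\<psi> has_derivative ?D) (at ((\<phi> \<circ> \<gamma>) 0))"
        using D \<gamma>0 by simp
    qed
    then have "(\<gamma> has_vector_derivative ?D ?w) (at 0)"
      unfolding has_vector_derivative_def
    proof (rule has_derivative_transform_eventually)
      show "eventually (\<lambda>t. (\<psi> \<circ> (\<phi> \<circ> \<gamma>)) t = \<gamma> t) (at 0 within UNIV)"
        using inMU by eventually_elim (simp add: \<psi>\<phi>)
      show "(\<psi> \<circ> (\<phi> \<circ> \<gamma>)) 0 = \<gamma> 0"
        using \<gamma>0 U \<psi>\<phi> by simp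
    qed simp
    then have "v = ?D ?w"
      using \<gamma>' vector_derivative_unique_at by blast
    with wL show "v \<in> ?D ` L" by blast
  next
    fix v assume "v \<in> ?D ` L"
    then obtain w where w: "w \<in> L" and v: "v = ?D w" by blast
    let ?l = "\<lambda>t::real. ?q + t *\<^sub>R w"
    have "open (?l -` V)"
      by (rule open_vimage[OF V]) (intro continuous_intros)
    moreover have "0 \<in> ?l -` V"
      using q by simp
    ultimately obtain e where e: "e > 0" "ball 0 e \<subseteq> ?l -` V"
      by (meson openE)
    have ball: "ball 0 e = {-e<..<e}"
      by (auto simp: dist_real_def)
    have line: "?l t \<in> L \<inter> V" if "t \<in> {-e<..<e}" for t
      using e that ball q w L by (auto simp: subspace_add subspace_scale)
    have l': "(?l has_vector_derivative w) (at 0)"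
      by (auto intro!: derivative_eq_intros)
    have "((\<psi> \<circ> ?l) has_vector_derivative ?D w) (at 0)"
    proof (rule vector_derivative_diff_chain_within[OF l' has_derivative_at_withinI])
      show "(\<psi> has_derivative ?D) (at (?l 0))"
        using D by simp
    qed
    then have "((\<lambda>t. \<psi> (?l t)) has_vector_derivative v) (at 0)"
      by (simp add: o_def v)
    moreover have "smooth_on {-e<..<e} (\<lambda>t. \<psi> (?l t))"
      unfolding smooth_on_def
    proof
      show "Ck_on k {-e<..<e} (\<lambda>t. \<psi> (?l t))" for k
        using line smooth(2) unfolding smooth_on_def by (intro Ck_on_line[OF V]) auto
    qed
    moreover have "(\<lambda>t. \<psi> (?l t)) ` {-e<..<e} \<subseteq> M"
      using line \<psi>_in_M by blast
    moreover have "\<psi> (?l 0) = p"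
      using \<psi>\<phi> U by simp
    ultimately show "v \<in> tangent_space M p"
      unfolding tangent_space_def using e(1) by blast
  qed
qed

lemma subspace_tangent_space:
  fixes M :: "'a::euclidean_space set"
  assumes "submanifold m M" and "p \<in> M"
  shows "subspace (tangent_space M p)"
proof -
  obtain U V L :: "'a set" and \<phi> \<psi> where chart: "open U" "p \<in> U" "open V" "homeomorphism U V \<phi> \<psi>"
      "smooth_on U \<phi>" "smooth_on V \<psi>" "subspace L" "\<phi> ` (M \<inter> U) = L \<inter> V"
    using assms unfolding submanifold_def by fast
  have "\<phi> p \<in> V"
    using chart assms(2) by blast
  then have "linear (frechet_derivative \<psi> (at (\<phi> p)))"
    using smooth_on_has_derivative[OF chart(6,3)] has_derivative_linear by blast
  then show ?thesis
    using tangent_space_eq_image[OF chart(1-3) assms(2) chart(4-8)] chart(7)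
    by (simp add: linear_subspace_image)
qed

section \<open>Geodesics and their principal normals\<close>

lemma orthogonal_diff_orth_proj:
  assumes W: "subspace W" and "w \<in> W"
  shows "orthogonal (v - orth_proj W v) w"
proof -
  obtain y z where yz: "y \<in> span W" "\<And>w. w \<in> span W \<Longrightarrow> orthogonal z w" "v = y + z"
    using orthogonal_subspace_decomp_exists by metis
  have span: "span W = W"
    using W by simp
  have ex: "y \<in> W \<and> (\<forall>w\<in>W. orthogonal (v - y) w)"
    using yz span by simp
  moreover have "u = y" if "u \<in> W \<and> (\<forall>w\<in>W. orthogonal (v - u) w)" for u
  proof -
    \<comment> \<open>\<open>u - y\<close> lies in \<open>W\<close> and, as a difference of two vectors orthogonal to \<open>W\<close>, in its complement.\<close>
    have "u - y \<in> W"
      using that ex W by (simp add: subspace_diff)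
    then have "(v - y) \<bullet> (u - y) = 0" "(v - u) \<bullet> (u - y) = 0"
      using that ex by (auto simp: orthogonal_def)
    then have "(u - y) \<bullet> (u - y) = 0"
      by (simp add: inner_diff_left)
    then show ?thesis by simp
  qed
  ultimately have "orth_proj W v = y"
    unfolding orth_proj_def by (rule the_equality)
  with ex assms(2) show ?thesis by simp
qed

lemma principal_normal_orthogonal_tangent_space:
  assumes "submanifold m M" and "unit_speed_geodesic M I \<alpha>" and "t \<in> I"
    and "w \<in> tangent_space M (\<alpha> t)"
  shows "principal_normal I \<alpha> t \<bullet> w = 0"
proof -
  have "\<alpha> t \<in> M"
    using assms(2,3) unfolding unit_speed_geodesic_def by blast
  moreover have
    "orth_proj (tangent_space M (\<alpha> t)) (vector_derivative (velocity I \<alpha>) (at t within I)) = 0"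
    using assms(2,3) unfolding unit_speed_geodesic_def cov_deriv_def by blast
  ultimately have "orthogonal (vector_derivative (velocity I \<alpha>) (at t within I)) w"
    using orthogonal_diff_orth_proj[OF subspace_tangent_space[OF assms(1)] assms(4)]
    by (metis diff_zero)
  then show ?thesis
    by (simp add: principal_normal_def orthogonal_def)
qed

lemma norm_principal_normal:
  assumes "curvature I \<alpha> t > 0"
  shows "norm (principal_normal I \<alpha> t) = 1"
  using assms by (simp add: principal_normal_def curvature_def)

theorem theorem3p2:
  fixes M :: "(real ^ 'n) set" and d :: "real ^ 'n" and \<xi> :: "real ^ 'n \<Rightarrow> real ^ 'n"
    and \<alpha> :: "real \<Rightarrow> real ^ 'n" and I :: "real set" and n k r :: nat
  assumes "n = CARD('n)" and "k \<le> n"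
    and "submanifold (n - k) M" and "strong_helix r M"
    and "unit_speed_geodesic M I \<alpha>"
    and "\<forall>t\<in>I. curvature I \<alpha> t > 0"
    and "norm d = 1" and "d \<in> helix_space M"
    and "normal_component M d \<xi>"
    and "(\<lambda>t. principal_normal I \<alpha> t \<bullet> \<xi> (\<alpha> t)) constant_on I"
  shows "slant_helix I \<alpha>"
proof -
  obtain \<theta> T where T: "unit_tangent_field M T"
      and d: "\<And>p. p \<in> M \<Longrightarrow> d = cos \<theta> *\<^sub>R \<xi> p + sin \<theta> *\<^sub>R T p"
    using assms(9) unfolding normal_component_def by blast
  obtain c where c: "\<And>t. t \<in> I \<Longrightarrow> principal_normal I \<alpha> t \<bullet> \<xi> (\<alpha> t) = c"
    using assms(10) unfolding constant_on_def by blast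
  have "vec_angle (principal_normal I \<alpha> t) d = arccos (cos \<theta> * c)" if t: "t \<in> I" for t
  proof -
    have M: "\<alpha> t \<in> M"
      using assms(5) t unfolding unit_speed_geodesic_def by blast
    then have "principal_normal I \<alpha> t \<bullet> T (\<alpha> t) = 0"
      using T principal_normal_orthogonal_tangent_space[OF assms(3,5) t]
      unfolding unit_tangent_field_def by blast
    then have "principal_normal I \<alpha> t \<bullet> d = cos \<theta> * c"
      by (subst d[OF M]) (simp add: inner_add_right c[OF t])
    then show ?thesis
      using assms(6,7) t by (simp add: vec_angle_def norm_principal_normal)
  qed
  then have "(\<lambda>t. vec_angle (principal_normal I \<alpha> t) d) constant_on I"
    unfolding constant_on_def by blast
  moreover have "unit_speed_curve I \<alpha>"
    using assms(5) unfolding unit_speed_geodesic_def by blast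
  ultimately show ?thesis
    unfolding slant_helix_def using assms(6,7) by blast
qed

end
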